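(* The system $$\dot x_1=x_3-x_2,\qquad \dot x_2=x_1-x_3,\qquad \dot x_3=x_2-x_1$$ on $\mathbb{R}^3$ has infinitely many Hamilton-Poisson realizations. Precisely, for all $a,b,c,d\in\mathbb{R}$ with $ad-bc=1$ (i.e. $\begin{pmatrix}a&b\\c&d\end{pmatrix}\in SL(2,\mathbb{R})$), $(\mathbb{R}^3,\Pi_{a,b},H_{c,d})$ is a Hamilton-Poisson realization of the system: the matrix $$\Pi_{a,b}=\begin{pmatrix}0&-b-ax_1-ax_2&b+ax_1+ax_3\\ b+ax_1+ax_2&0&-b-ax_2-ax_3\\ -b-ax_1-ax_3&b+ax_2+ax_3&0\end{pmatrix}$$ is a Poisson structure on $\mathbb{R}^3$, and with $$H_{c,d}=c(x_1x_2+x_2x_3+x_3x_1)+d(x_1+x_2+x_3)$$ the system is $$\dot{\mathbf{x}}=\Pi_{a,b}\cdot\nabla H_{c,d},\qquad \mathbf{x}=(x_1,x_2,x_3)^T.$$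
   Context: A Hamilton-Poisson realization of a system $\dot{\mathbf x}=F(\mathbf x)$ on $\mathbb{R}^3$ is a triple $(\mathbb{R}^3,\Pi,H)$, where $\Pi$ is a skew-symmetric matrix of functions such that $\{f,g\}=(\nabla f)^T\Pi\nabla g$ is a Poisson bracket on $\mathbb{R}^3$ (in particular satisfies the Jacobi identity), $H$ is a smooth function, and $F=\Pi\nabla H$. *)

theory Defs
  imports "HOL-Analysis.Analysis"
begin

definition partial_deriv :: "'n \<Rightarrow> (real^'n \<Rightarrow> real) \<Rightarrow> real^'n \<Rightarrow> real"
  where "partial_deriv i f x = frechet_derivative f (at x) (axis i 1)"

definition grad :: "(real^'n \<Rightarrow> real) \<Rightarrow> real^'n \<Rightarrow> real^'n"
  where "grad f x = (\<chi> i. partial_deriv i f x)"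

lemma GDERIV_imp_grad:
  assumes "GDERIV f x :> D"
  shows "grad f x = D"
proof -
  have "(f has_derivative (\<lambda>h. inner h D)) (at x)"
    using assms by (simp add: gderiv_def)
  then have "frechet_derivative f (at x) = (\<lambda>h. inner h D)"
    using frechet_derivative_at by metis
  then show ?thesis
    by (simp add: grad_def partial_deriv_def vec_eq_iff inner_axis')
qed

(* C^k on the whole space. Total differentiability is required along with the
   partial derivatives because frechet_derivative is an unspecified function at
   points of non-differentiability; for C^k functions it is automatic. *)
fun Ck_fun :: "nat \<Rightarrow> (real^'n \<Rightarrow> real) \<Rightarrow> bool"
  where
    "Ck_fun 0 f \<longleftrightarrow> continuous_on UNIV f"
  | "Ck_fun (Suc k) f \<longleftrightarrow> f differentiable_on UNIV \<and> (\<forall>i. Ck_fun k (partial_deriv i f))"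

definition smooth_fun :: "(real^'n \<Rightarrow> real) \<Rightarrow> bool"
  where "smooth_fun f \<longleftrightarrow> (\<forall>k. Ck_fun k f)"

(* A Poisson bracket is a Lie bracket on the algebra of smooth functions that is a
   derivation in each argument. Linearity and the Leibniz rule in the second argument
   follow from skew-symmetry. *)
definition poisson_bracket ::
    "((real^'n \<Rightarrow> real) \<Rightarrow> (real^'n \<Rightarrow> real) \<Rightarrow> real^'n \<Rightarrow> real) \<Rightarrow> bool"
  where "poisson_bracket br \<longleftrightarrow>
    (\<forall>f g. smooth_fun f \<longrightarrow> smooth_fun g \<longrightarrow> smooth_fun (br f g)) \<and>
    (\<forall>r s f g h. smooth_fun f \<longrightarrow> smooth_fun g \<longrightarrow> smooth_fun h \<longrightarrow>
       br (\<lambda>x. r * f x + s * g x) h = (\<lambda>x. r * br f h x + s * br g h x)) \<and>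
    (\<forall>f g. smooth_fun f \<longrightarrow> smooth_fun g \<longrightarrow> br f g = (\<lambda>x. - br g f x)) \<and>
    (\<forall>f g h. smooth_fun f \<longrightarrow> smooth_fun g \<longrightarrow> smooth_fun h \<longrightarrow>
       br (\<lambda>x. f x * g x) h = (\<lambda>x. f x * br g h x + g x * br f h x)) \<and>
    (\<forall>f g h. smooth_fun f \<longrightarrow> smooth_fun g \<longrightarrow> smooth_fun h \<longrightarrow>
       (\<forall>x. br (br f g) h x + br (br g h) f x + br (br h f) g x = 0))"

definition bracket_of ::
    "(real^'n \<Rightarrow> real^'n^'n) \<Rightarrow> (real^'n \<Rightarrow> real) \<Rightarrow> (real^'n \<Rightarrow> real) \<Rightarrow> real^'n \<Rightarrow> real"
  where "bracket_of P f g x = grad f x \<bullet> (P x *v grad g x)"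

(* Smoothness of the entries P x $ i $ j need not be demanded separately: they are the
   brackets of coordinate functions. *)
definition poisson_structure :: "(real^'n \<Rightarrow> real^'n^'n) \<Rightarrow> bool"
  where "poisson_structure P \<longleftrightarrow>
    (\<forall>x. transpose (P x) = - P x) \<and> poisson_bracket (bracket_of P)"

definition hamilton_poisson_realization ::
    "(real^'n \<Rightarrow> real^'n^'n) \<Rightarrow> (real^'n \<Rightarrow> real) \<Rightarrow> (real^'n \<Rightarrow> real^'n) \<Rightarrow> bool"
  where "hamilton_poisson_realization P H F \<longleftrightarrow>
    poisson_structure P \<and> smooth_fun H \<and> (\<forall>x. F x = P x *v grad H x)"

definition system_field :: "real^3 \<Rightarrow> real^3"
  where "system_field x = vector [x$3 - x$2, x$1 - x$3, x$2 - x$1]"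

definition Pi_mat :: "real \<Rightarrow> real \<Rightarrow> real^3 \<Rightarrow> real^3^3"
  where "Pi_mat a b x = vector
    [vector [0, - b - a * x$1 - a * x$2, b + a * x$1 + a * x$3],
     vector [b + a * x$1 + a * x$2, 0, - b - a * x$2 - a * x$3],
     vector [- b - a * x$1 - a * x$3, b + a * x$2 + a * x$3, 0]]"

definition Ham :: "real \<Rightarrow> real \<Rightarrow> real^3 \<Rightarrow> real"
  where "Ham c d x = c * (x$1 * x$2 + x$2 * x$3 + x$3 * x$1) + d * (x$1 + x$2 + x$3)"

end

theory Submission
  imports Defs
begin

text \<open>
  Put \<open>q x = x\<^sub>1 x\<^sub>2 + x\<^sub>2 x\<^sub>3 + x\<^sub>3 x\<^sub>1\<close> and \<open>s x = x\<^sub>1 + x\<^sub>2 + x\<^sub>3\<close>. The system is the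
  cross product of the gradients of its two first integrals \<open>q\<close> and \<open>s\<close>, and the matrix
  \<open>\<Pi>\<^bsub>a,b\<^esub>\<close> acts as \<open>v \<mapsto> \<nabla>(a q + b s) \<times> v\<close>. Since the cross product is bilinear and
  alternating, \<open>\<nabla>(a q + b s) \<times> \<nabla>(c q + d s) = (a d - b c) (\<nabla>q \<times> \<nabla>s)\<close>, which is the given
  field as soon as the determinant is 1 (\<open>system_field_eq\<close>).

  What remains is that \<open>\<Pi>\<^bsub>a,b\<^esub>\<close> is a Poisson structure. Skew-symmetry, bilinearity and the
  Leibniz rule come from the form \<open>(\<nabla>f)\<^sup>T \<Pi> \<nabla>g\<close>, so the content is the Jacobi identity for
  arbitrary smooth functions. In any dimension it reduces to an identity between the entries of
  the matrix and their first derivatives (\<open>bracket_of_jacobi\<close>). Write \<open>X\<^sub>g = \<Pi> \<nabla>g\<close>.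
  Differentiating \<open>{f,g}\<close> along \<open>X\<^sub>h\<close> gives a term \<open>J(f,g,h)\<close> in which only the entries of \<open>\<Pi>\<close>
  are differentiated, plus \<open>D\<^sup>2f(X\<^sub>g,X\<^sub>h) - D\<^sup>2g(X\<^sub>f,X\<^sub>h)\<close>, where the sign is due to skew-symmetry.
  In the cyclic sum every Hessian appears twice with opposite signs and with its arguments
  exchanged, so the second-order part vanishes because Hessians are symmetric. The cyclic sum
  of \<open>J\<close> vanishes by the identity for the entries, which for the affine entries of
  \<open>\<Pi>\<^bsub>a,b\<^esub>\<close> is a finite computation.

  Symmetry of the Hessian (\<open>partial_deriv_commute\<close>) is proved for smooth functions by writing
  one second difference as a mixed partial derivative in both orders.
\<close>

section \<open>Gradients and partial derivatives\<close>

text \<open>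
  Where the function is differentiable, the gradient assembled from the partial derivatives
  represents the total derivative; the sum and product rules for gradients then yield those
  for partial derivatives.
\<close>

lemma GDERIV_grad:
  fixes f :: "real^'n \<Rightarrow> real"
  assumes "f differentiable (at x)"
  shows "GDERIV f x :> grad f x"
proof -
  let ?f' = "frechet_derivative f (at x)"
  have lin: "linear ?f'"
    using assms by (rule linear_frechet_derivative)
  have "?f' = (\<lambda>h. h \<bullet> grad f x)"
  proof
    fix h
    have "?f' h = ?f' (\<Sum>i\<in>UNIV. h$i *\<^sub>R axis i 1)"
      using basis_expansion[of h] by (simp add: scalar_mult_eq_scaleR)
    also have "\<dots> = (\<Sum>i\<in>UNIV. h$i * ?f' (axis i 1))"
      using lin by (simp add: linear_sum linear_scale)
    finally show "?f' h = h \<bullet> grad f x"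
      by (simp add: inner_vec_def grad_def partial_deriv_def)
  qed
  then show ?thesis
    using assms unfolding gderiv_def frechet_derivative_works by simp
qed

lemma partial_deriv_eq_grad: "partial_deriv i f x = grad f x $ i"
  by (simp add: grad_def)

lemma partial_deriv_eqI:
  "(f has_derivative f') (at x) \<Longrightarrow> partial_deriv i f x = f' (axis i 1)"
  by (simp add: partial_deriv_def flip: frechet_derivative_at)

lemma partial_deriv_const [simp]: "partial_deriv i (\<lambda>x. c) = (\<lambda>x. 0)"
  by (simp add: partial_deriv_def fun_eq_iff)

lemma partial_deriv_component:
  "partial_deriv i (\<lambda>x :: real^'n. x $ j) = (\<lambda>x. if i = j then 1 else 0)"
proof
  fix x :: "real^'n"
  have "((\<lambda>x. x $ j) has_derivative (\<lambda>h. h $ j)) (at x)"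
    by (intro bounded_linear_imp_has_derivative bounded_linear_vec_nth)
  then show "partial_deriv i (\<lambda>x. x $ j) x = (if i = j then 1 else 0)"
    by (auto simp: partial_deriv_eqI axis_def)
qed

lemma partial_deriv_add:
  assumes "f differentiable (at x)" "g differentiable (at x)"
  shows "partial_deriv i (\<lambda>x. f x + g x) x = partial_deriv i f x + partial_deriv i g x"
  using GDERIV_imp_grad[OF GDERIV_add[OF assms[THEN GDERIV_grad]]]
  by (simp add: partial_deriv_eq_grad)

lemma partial_deriv_mult:
  assumes "f differentiable (at x)" "g differentiable (at x)"
  shows "partial_deriv i (\<lambda>x. f x * g x) x = f x * partial_deriv i g x + g x * partial_deriv i f x"
  using GDERIV_imp_grad[OF GDERIV_mult[OF assms[THEN GDERIV_grad]]]
  by (simp add: partial_deriv_eq_grad)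

lemma partial_deriv_sum:
  assumes "finite I" "\<And>k. k \<in> I \<Longrightarrow> F k differentiable (at x)"
  shows "partial_deriv i (\<lambda>x. \<Sum>k\<in>I. F k x) x = (\<Sum>k\<in>I. partial_deriv i (F k) x)"
  using assms
  by (induction rule: finite_induct)
     (simp_all add: partial_deriv_add differentiable_sum)

section \<open>The algebra of smooth functions\<close>

lemma Ck_fun_Suc_imp_Ck_fun: "Ck_fun (Suc k) f \<Longrightarrow> Ck_fun k f"
  by (induction k arbitrary: f) (auto simp: differentiable_imp_continuous_on)

lemma Ck_fun_const: "Ck_fun k (\<lambda>x. c)"
  by (induction k arbitrary: c) (auto simp: differentiable_on_def)

lemma Ck_fun_add:
  "Ck_fun k f \<Longrightarrow> Ck_fun k g \<Longrightarrow> Ck_fun k (\<lambda>x. f x + g x)"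
proof (induction k arbitrary: f g)
  case 0
  then show ?case by (simp add: continuous_on_add)
next
  case (Suc k)
  then have d: "f differentiable (at x)" "g differentiable (at x)" for x
    by (auto simp: differentiable_on_def)
  have "partial_deriv i (\<lambda>x. f x + g x) = (\<lambda>x. partial_deriv i f x + partial_deriv i g x)" for i
    using d by (simp add: fun_eq_iff partial_deriv_add)
  with Suc d show ?case by (simp add: differentiable_on_def)
qed

text \<open>
  In the induction step the product rule multiplies a derivative, which is one degree less
  smooth, by an undifferentiated factor; that factor has to be weakened to the same degree.
\<close>

lemma Ck_fun_mult:
  "Ck_fun k f \<Longrightarrow> Ck_fun k g \<Longrightarrow> Ck_fun k (\<lambda>x. f x * g x)"
proof (induction k arbitrary: f g)
  case 0
  then show ?case by (simp add: continuous_on_mult)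
next
  case (Suc k)
  then have d: "f differentiable (at x)" "g differentiable (at x)" for x
    by (auto simp: differentiable_on_def)
  have "partial_deriv i (\<lambda>x. f x * g x)
      = (\<lambda>x. f x * partial_deriv i g x + g x * partial_deriv i f x)" for i
    using d by (simp add: fun_eq_iff partial_deriv_mult)
  moreover have "Ck_fun k f" "Ck_fun k g"
    using Suc.prems by (auto intro: Ck_fun_Suc_imp_Ck_fun)
  ultimately show ?case
    using Suc d by (simp add: differentiable_on_def Ck_fun_add)
qed

lemma smooth_fun_differentiable: "smooth_fun f \<Longrightarrow> f differentiable (at x)"
  unfolding smooth_fun_def using Ck_fun.simps(2)[of 0 f] by (auto simp: differentiable_on_def)

lemma smooth_fun_continuous: "smooth_fun f \<Longrightarrow> continuous_on UNIV f"
  unfolding smooth_fun_def using Ck_fun.simps(1)[of f] by blast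

lemma smooth_fun_partial_deriv: "smooth_fun f \<Longrightarrow> smooth_fun (partial_deriv i f)"
  unfolding smooth_fun_def using Ck_fun.simps(2) by blast

lemma smooth_fun_const: "smooth_fun (\<lambda>x. c)"
  by (simp add: smooth_fun_def Ck_fun_const)

lemma smooth_fun_component: "smooth_fun (\<lambda>x. x $ j)"
  unfolding smooth_fun_def
proof
  fix k
  show "Ck_fun k (\<lambda>x. x $ j)"
    by (cases k) (auto simp: partial_deriv_component Ck_fun_const differentiable_on_def
        intro!: bounded_linear_imp_differentiable linear_continuous_on)
qed

lemma smooth_fun_add: "smooth_fun f \<Longrightarrow> smooth_fun g \<Longrightarrow> smooth_fun (\<lambda>x. f x + g x)"
  by (simp add: smooth_fun_def Ck_fun_add)

lemma smooth_fun_mult: "smooth_fun f \<Longrightarrow> smooth_fun g \<Longrightarrow> smooth_fun (\<lambda>x. f x * g x)"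
  by (simp add: smooth_fun_def Ck_fun_mult)

lemma smooth_fun_minus: "smooth_fun f \<Longrightarrow> smooth_fun (\<lambda>x. - f x)"
  using smooth_fun_mult[OF smooth_fun_const[of "-1"]] by simp

lemma smooth_fun_diff: "smooth_fun f \<Longrightarrow> smooth_fun g \<Longrightarrow> smooth_fun (\<lambda>x. f x - g x)"
  using smooth_fun_add[OF _ smooth_fun_minus] by simp

lemma smooth_fun_sum: "(\<And>k. k \<in> I \<Longrightarrow> smooth_fun (F k)) \<Longrightarrow> smooth_fun (\<lambda>x. \<Sum>k\<in>I. F k x)"
  by (induction I rule: infinite_finite_induct) (simp_all add: smooth_fun_const smooth_fun_add)

lemmas smooth_fun_intros =
  smooth_fun_const smooth_fun_component smooth_fun_add smooth_fun_mult smooth_fun_minus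
  smooth_fun_diff smooth_fun_sum smooth_fun_partial_deriv

section \<open>Symmetry of second derivatives\<close>

lemma DERIV_along_axis:
  fixes f :: "real^'n \<Rightarrow> real"
  assumes "f differentiable (at (p + s *\<^sub>R axis i 1))"
  shows "((\<lambda>s. f (p + s *\<^sub>R axis i 1)) has_real_derivative
           partial_deriv i f (p + s *\<^sub>R axis i 1)) (at s)"
proof -
  let ?e = "axis i 1 :: real^'n"
  have "((\<lambda>s. p + s *\<^sub>R ?e) has_derivative (\<lambda>h. h *\<^sub>R ?e)) (at s)"
    by (rule derivative_eq_intros refl)+ simp
  moreover have "(f has_derivative (\<lambda>h. h \<bullet> grad f (p + s *\<^sub>R ?e))) (at (p + s *\<^sub>R ?e))"
    using GDERIV_grad[OF assms] by (simp add: gderiv_def)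
  ultimately have "((\<lambda>s. f (p + s *\<^sub>R ?e)) has_derivative
      (\<lambda>h. (h *\<^sub>R ?e) \<bullet> grad f (p + s *\<^sub>R ?e))) (at s)"
    by (rule has_derivative_compose)
  moreover have "(\<lambda>h. (h *\<^sub>R ?e) \<bullet> grad f (p + s *\<^sub>R ?e))
      = (*) (partial_deriv i f (p + s *\<^sub>R ?e))"
    by (simp add: fun_eq_iff inner_axis' partial_deriv_eq_grad)
  ultimately show ?thesis
    by (simp only: has_field_derivative_def)
qed

text \<open>
  The second difference over a square of side \<open>t\<close> is the increment in direction \<open>i\<close> of an
  increment in direction \<open>j\<close>. One application of the mean value theorem in each direction turns
  it into a mixed partial derivative at a point of the square. The second difference does not
  depend on the order of \<open>i\<close> and \<open>j\<close>, so exchanging them relates the two mixed derivatives.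
\<close>

lemma second_difference_mvt:
  fixes f :: "real^'n \<Rightarrow> real"
  assumes f: "\<And>x. f differentiable (at x)" and fi: "\<And>x. partial_deriv i f differentiable (at x)"
    and t: "0 < t"
  obtains s r where "0 < s" "s < t" "0 < r" "r < t"
    "f (x + t *\<^sub>R axis i 1 + t *\<^sub>R axis j 1) - f (x + t *\<^sub>R axis i 1)
       - f (x + t *\<^sub>R axis j 1) + f x
     = t\<^sup>2 * partial_deriv j (partial_deriv i f) (x + s *\<^sub>R axis i 1 + r *\<^sub>R axis j 1)"
proof -
  let ?ei = "axis i 1 :: real^'n" and ?ej = "axis j 1 :: real^'n"
  define \<phi> where "\<phi> s = f ((x + t *\<^sub>R ?ej) + s *\<^sub>R ?ei) - f (x + s *\<^sub>R ?ei)" for s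
  have "(\<phi> has_real_derivative partial_deriv i f ((x + t *\<^sub>R ?ej) + s *\<^sub>R ?ei)
      - partial_deriv i f (x + s *\<^sub>R ?ei)) (at s)" for s
    unfolding \<phi>_def by (intro DERIV_diff DERIV_along_axis f)
  from MVT2[OF t this] obtain s where s: "0 < s" "s < t"
    and 1: "\<phi> t - \<phi> 0 = t * (partial_deriv i f ((x + t *\<^sub>R ?ej) + s *\<^sub>R ?ei)
              - partial_deriv i f (x + s *\<^sub>R ?ei))"
    by auto
  have "((\<lambda>r. partial_deriv i f ((x + s *\<^sub>R ?ei) + r *\<^sub>R ?ej)) has_real_derivative
      partial_deriv j (partial_deriv i f) ((x + s *\<^sub>R ?ei) + r *\<^sub>R ?ej)) (at r)" for r
    by (intro DERIV_along_axis fi)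
  from MVT2[OF t this] obtain r where r: "0 < r" "r < t"
    and 2: "partial_deriv i f ((x + s *\<^sub>R ?ei) + t *\<^sub>R ?ej) - partial_deriv i f (x + s *\<^sub>R ?ei)
        = t * partial_deriv j (partial_deriv i f) ((x + s *\<^sub>R ?ei) + r *\<^sub>R ?ej)"
    by auto
  have "\<phi> t - \<phi> 0 = t\<^sup>2 * partial_deriv j (partial_deriv i f) (x + s *\<^sub>R ?ei + r *\<^sub>R ?ej)"
    using 1 2 by (simp add: power2_eq_square add_ac)
  then show ?thesis
    using s r by (intro that[of s r]) (simp_all add: \<phi>_def algebra_simps)
qed

text \<open>
  Both mixed derivatives, at suitable points of the same square, equal the second difference
  divided by \<open>t\<^sup>2\<close>. As the square shrinks to \<open>x\<close>, continuity makes them agree at \<open>x\<close>.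
\<close>

lemma partial_deriv_commute:
  fixes f :: "real^'n \<Rightarrow> real"
  assumes "smooth_fun f"
  shows "partial_deriv i (partial_deriv j f) x = partial_deriv j (partial_deriv i f) x"
proof -
  let ?ei = "axis i 1 :: real^'n" and ?ej = "axis j 1 :: real^'n"
  let ?A = "partial_deriv i (partial_deriv j f)" and ?B = "partial_deriv j (partial_deriv i f)"
  note d = smooth_fun_differentiable[OF assms]
    smooth_fun_differentiable[OF smooth_fun_partial_deriv[OF assms]]
  have close: "dist (x + s *\<^sub>R axis k 1 + r *\<^sub>R axis l 1) x \<le> 2 * t"
    if "0 < s" "s < t" "0 < r" "r < t" for s r t :: real and k l :: 'n
    using that norm_triangle_ineq[of "s *\<^sub>R axis k 1 :: real^'n" "r *\<^sub>R axis l 1"]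
    by (simp add: dist_norm add.assoc)
  have near: "\<exists>p q. dist p x \<le> 2 * t \<and> dist q x \<le> 2 * t \<and> ?A p = ?B q" if t: "0 < t" for t
  proof -
    obtain s r where sr: "0 < s" "s < t" "0 < r" "r < t"
      and 1: "f (x + t *\<^sub>R ?ei + t *\<^sub>R ?ej) - f (x + t *\<^sub>R ?ei) - f (x + t *\<^sub>R ?ej) + f x
        = t\<^sup>2 * ?B (x + s *\<^sub>R ?ei + r *\<^sub>R ?ej)"
      using second_difference_mvt[OF d t, where i = i and j = j and x = x] .
    obtain s' r' where sr': "0 < s'" "s' < t" "0 < r'" "r' < t"
      and 2: "f (x + t *\<^sub>R ?ej + t *\<^sub>R ?ei) - f (x + t *\<^sub>R ?ej) - f (x + t *\<^sub>R ?ei) + f x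
        = t\<^sup>2 * ?A (x + s' *\<^sub>R ?ej + r' *\<^sub>R ?ei)"
      using second_difference_mvt[OF d t, where i = j and j = i and x = x] .
    have swap: "x + t *\<^sub>R ?ej + t *\<^sub>R ?ei = x + t *\<^sub>R ?ei + t *\<^sub>R ?ej"
      by (simp add: add_ac)
    have "t\<^sup>2 * ?A (x + s' *\<^sub>R ?ej + r' *\<^sub>R ?ei) = t\<^sup>2 * ?B (x + s *\<^sub>R ?ei + r *\<^sub>R ?ej)"
      using 1 2[unfolded swap] by linarith
    then have "?A (x + s' *\<^sub>R ?ej + r' *\<^sub>R ?ei) = ?B (x + s *\<^sub>R ?ei + r *\<^sub>R ?ej)"
      using t by simp
    with close[OF sr] close[OF sr'] show ?thesis
      by blast
  qed
  have "\<exists>p q. dist p x \<le> 2 * (1 / real (Suc n)) \<and> dist q x \<le> 2 * (1 / real (Suc n)) \<and> ?A p = ?B q" for n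
    using near[of "1 / real (Suc n)"] by (meson of_nat_0_less_iff zero_less_Suc zero_less_divide_1_iff)
  then obtain p q where p: "\<And>n. dist (p n) x \<le> 2 * (1 / real (Suc n))"
    and q: "\<And>n. dist (q n) x \<le> 2 * (1 / real (Suc n))" and pq: "\<And>n. ?A (p n) = ?B (q n)"
    by metis
  have lim0: "(\<lambda>n. 2 * (1 / real (Suc n))) \<longlonglongrightarrow> 0"
    using tendsto_mult_right_zero[OF LIMSEQ_inverse_real_of_nat, of 2] by (simp add: inverse_eq_divide)
  have "p \<longlonglongrightarrow> x" "q \<longlonglongrightarrow> x"
    using p q by (auto intro!: metric_tendsto_imp_tendsto[OF lim0] always_eventually)
  moreover have "isCont ?A x" "isCont ?B x"
    using smooth_fun_continuous[of ?A] smooth_fun_continuous[of ?B] assms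
    by (auto simp: smooth_fun_partial_deriv continuous_on_eq_continuous_at)
  ultimately have "(\<lambda>n. ?A (p n)) \<longlonglongrightarrow> ?A x" "(\<lambda>n. ?B (q n)) \<longlonglongrightarrow> ?B x"
    by (auto intro: isCont_tendsto_compose)
  then show ?thesis
    using pq LIMSEQ_unique by simp
qed

section \<open>Poisson structures from skew-symmetric matrix fields\<close>

text \<open>
  Read this way, \<open>{f,g}\<close> is the derivative of \<open>f\<close> along the Hamiltonian vector field
  \<open>\<Pi> \<nabla>g\<close>.
\<close>

lemma bracket_of_eq_sum_field:
  "bracket_of P f g x = (\<Sum>l\<in>UNIV. partial_deriv l f x * (P x *v grad g x) $ l)"
  by (simp add: bracket_of_def inner_vec_def partial_deriv_eq_grad)

lemma bracket_of_eq_sum_entries: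
  "bracket_of P f g x =
     (\<Sum>i\<in>UNIV. \<Sum>j\<in>UNIV. P x $ i $ j * (partial_deriv i f x * partial_deriv j g x))"
  by (simp add: bracket_of_eq_sum_field matrix_vector_mult_def partial_deriv_eq_grad
      sum_distrib_left mult_ac)

lemma bracket_of_skew:
  assumes "transpose (P x) = - P x"
  shows "bracket_of P f g x = - bracket_of P g f x"
proof -
  have "bracket_of P f g x = (transpose (P x) *v grad f x) \<bullet> grad g x"
    by (simp add: bracket_of_def dot_lmul_matrix)
  also have "\<dots> = - bracket_of P g f x"
    by (simp add: assms bracket_of_def inner_commute[of "grad f x"] matrix_vector_mult_def inner_vec_def sum_negf mult.commute)
  finally show ?thesis .
qed

lemma smooth_fun_bracket_of:
  assumes "\<And>i j. smooth_fun (\<lambda>x. P x $ i $ j)" "smooth_fun f" "smooth_fun g"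
  shows "smooth_fun (bracket_of P f g)"
proof -
  have "bracket_of P f g =
      (\<lambda>x. \<Sum>i\<in>UNIV. \<Sum>j\<in>UNIV. P x $ i $ j * (partial_deriv i f x * partial_deriv j g x))"
    by (simp add: fun_eq_iff bracket_of_eq_sum_entries)
  then show ?thesis
    using assms by (simp add: smooth_fun_intros)
qed

text \<open>
  The product rule on \<open>{f,g} = \<Sum>\<^sub>i\<^sub>j \<Pi>\<^sub>i\<^sub>j \<partial>\<^sub>if \<partial>\<^sub>jg\<close>. The second derivatives of \<open>f\<close> are paired with
  \<open>\<Pi> \<nabla>g\<close>, those of \<open>g\<close> with \<open>\<Pi>\<^sup>T \<nabla>f = - \<Pi> \<nabla>f\<close>, which explains the minus sign.
\<close>

lemma partial_deriv_bracket_of: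
  fixes P :: "real^'n \<Rightarrow> real^'n^'n"
  assumes skew: "transpose (P x) = - P x"
    and P: "\<And>i j. smooth_fun (\<lambda>x. P x $ i $ j)" and f: "smooth_fun f" and g: "smooth_fun g"
  shows "partial_deriv l (bracket_of P f g) x =
      (\<Sum>i\<in>UNIV. \<Sum>j\<in>UNIV. partial_deriv l (\<lambda>x. P x $ i $ j) x * (partial_deriv i f x * partial_deriv j g x))
    + (\<Sum>i\<in>UNIV. partial_deriv l (partial_deriv i f) x * (P x *v grad g x) $ i)
    - (\<Sum>j\<in>UNIV. partial_deriv l (partial_deriv j g) x * (P x *v grad f x) $ j)"
proof -
  note diff = smooth_fun_differentiable[OF P] smooth_fun_differentiable[OF smooth_fun_partial_deriv[OF f]]
    smooth_fun_differentiable[OF smooth_fun_partial_deriv[OF g]]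
  have entry: "partial_deriv l (\<lambda>x. P x $ i $ j * (partial_deriv i f x * partial_deriv j g x)) x
      = partial_deriv l (\<lambda>x. P x $ i $ j) x * (partial_deriv i f x * partial_deriv j g x)
        + partial_deriv l (partial_deriv i f) x * (P x $ i $ j * partial_deriv j g x)
        + partial_deriv l (partial_deriv j g) x * (P x $ i $ j * partial_deriv i f x)" for i j
    by (simp add: partial_deriv_mult differentiable_mult diff) (simp add: algebra_simps)
  have "bracket_of P f g =
      (\<lambda>x. \<Sum>i\<in>UNIV. \<Sum>j\<in>UNIV. P x $ i $ j * (partial_deriv i f x * partial_deriv j g x))"
    by (simp add: fun_eq_iff bracket_of_eq_sum_entries)
  then have "partial_deriv l (bracket_of P f g) x =
      (\<Sum>i\<in>UNIV. \<Sum>j\<in>UNIV. partial_deriv l (\<lambda>x. P x $ i $ j * (partial_deriv i f x * partial_deriv j g x)) x)"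
    by (simp add: partial_deriv_sum differentiable_sum differentiable_mult diff)
  also have "\<dots> =
      (\<Sum>i\<in>UNIV. \<Sum>j\<in>UNIV. partial_deriv l (\<lambda>x. P x $ i $ j) x * (partial_deriv i f x * partial_deriv j g x))
    + (\<Sum>i\<in>UNIV. \<Sum>j\<in>UNIV. partial_deriv l (partial_deriv i f) x * (P x $ i $ j * partial_deriv j g x))
    + (\<Sum>i\<in>UNIV. \<Sum>j\<in>UNIV. partial_deriv l (partial_deriv j g) x * (P x $ i $ j * partial_deriv i f x))"
    by (simp only: entry sum.distrib)
  also have "(\<Sum>i\<in>UNIV. \<Sum>j\<in>UNIV. partial_deriv l (partial_deriv i f) x * (P x $ i $ j * partial_deriv j g x))
      = (\<Sum>i\<in>UNIV. partial_deriv l (partial_deriv i f) x * (P x *v grad g x) $ i)"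
    by (simp add: matrix_vector_mult_def partial_deriv_eq_grad sum_distrib_left)
  also have "(\<Sum>i\<in>UNIV. \<Sum>j\<in>UNIV. partial_deriv l (partial_deriv j g) x * (P x $ i $ j * partial_deriv i f x))
      = - (\<Sum>j\<in>UNIV. partial_deriv l (partial_deriv j g) x * (P x *v grad f x) $ j)"
  proof -
    have skew_entry: "P x $ i $ j = - P x $ j $ i" for i j
      using arg_cong[OF skew, of "\<lambda>M. M $ j $ i"] by (simp add: transpose_def)
    have "(\<Sum>i\<in>UNIV. P x $ i $ j * partial_deriv i f x)
        = (\<Sum>i\<in>UNIV. - P x $ j $ i * partial_deriv i f x)" for j
      by (intro sum.cong refl arg_cong2[of _ _ _ _ "(*)"] skew_entry)
    then have col: "(\<Sum>i\<in>UNIV. P x $ i $ j * partial_deriv i f x) = - (P x *v grad f x) $ j" for j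
      by (simp add: matrix_vector_mult_def partial_deriv_eq_grad sum_negf)
    show ?thesis
      by (subst sum.swap) (simp add: sum_distrib_left[symmetric] col sum_negf)
  qed
  finally show ?thesis by simp
qed

text \<open>
  The hypothesis on the entries is the Jacobi identity for the coordinate functions. It is
  enough, because the second derivatives of \<open>f\<close>, \<open>g\<close> and \<open>h\<close> drop out of the cyclic sum:
  below, \<open>T u v w\<close> is the Hessian of \<open>u\<close> evaluated on \<open>X v\<close> and \<open>X w\<close>, and the six such terms
  cancel in pairs by its symmetry.
\<close>

lemma bracket_of_jacobi:
  fixes P :: "real^'n \<Rightarrow> real^'n^'n"
  assumes skew: "transpose (P x) = - P x"
    and P: "\<And>i j. smooth_fun (\<lambda>x. P x $ i $ j)"
    and jacobi: "\<And>i j k. (\<Sum>l\<in>UNIV. P x $ l $ k * partial_deriv l (\<lambda>x. P x $ i $ j) x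
        + P x $ l $ i * partial_deriv l (\<lambda>x. P x $ j $ k) x
        + P x $ l $ j * partial_deriv l (\<lambda>x. P x $ k $ i) x) = 0"
    and f: "smooth_fun f" and g: "smooth_fun g" and h: "smooth_fun h"
  shows "bracket_of P (bracket_of P f g) h x + bracket_of P (bracket_of P g h) f x
    + bracket_of P (bracket_of P h f) g x = 0"
proof -
  define X where "X g = P x *v grad g x" for g
  define D where "D i j k = (\<Sum>l\<in>UNIV. P x $ l $ k * partial_deriv l (\<lambda>x. P x $ i $ j) x)" for i j k
  define J where "J u v w = (\<Sum>i\<in>UNIV. \<Sum>j\<in>UNIV. \<Sum>k\<in>UNIV.
      D i j k * (partial_deriv i u x * partial_deriv j v x * partial_deriv k w x))" for u v w
  define T where "T u v w = (\<Sum>l\<in>UNIV. \<Sum>i\<in>UNIV. partial_deriv l (partial_deriv i u) x * X v $ i * X w $ l)"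
    for u v w
  have T_sym: "T u v w = T u w v" if "smooth_fun u" for u v w
  proof -
    have "T u v w = (\<Sum>i\<in>UNIV. \<Sum>l\<in>UNIV. partial_deriv l (partial_deriv i u) x * X v $ i * X w $ l)"
      unfolding T_def by (rule sum.swap)
    also have "\<dots> = T u w v"
      unfolding T_def
    proof (intro sum.cong refl)
      fix i l
      show "partial_deriv l (partial_deriv i u) x * X v $ i * X w $ l
          = partial_deriv i (partial_deriv l u) x * X w $ l * X v $ i"
        using partial_deriv_commute[OF that, of l i x] by simp
    qed
    finally show ?thesis .
  qed
  \<comment> \<open>\<open>J\<close> collects the terms of the nested bracket in which \<open>P\<close> itself is differentiated.\<close>
  have nested: "bracket_of P (bracket_of P u v) w x = J u v w + T u v w - T v u w"
    if "smooth_fun u" "smooth_fun v" for u v w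
  proof -
    have "(\<Sum>l\<in>UNIV. (\<Sum>i\<in>UNIV. \<Sum>j\<in>UNIV. partial_deriv l (\<lambda>x. P x $ i $ j) x
              * (partial_deriv i u x * partial_deriv j v x)) * X w $ l)
        = (\<Sum>l\<in>UNIV. \<Sum>i\<in>UNIV. \<Sum>j\<in>UNIV. \<Sum>k\<in>UNIV. P x $ l $ k * partial_deriv l (\<lambda>x. P x $ i $ j) x
              * (partial_deriv i u x * partial_deriv j v x * partial_deriv k w x))"
      by (simp add: X_def matrix_vector_mult_def partial_deriv_eq_grad[of _ w] sum_distrib_left sum_distrib_right mult_ac)
    also have "\<dots> = (\<Sum>i\<in>UNIV. \<Sum>l\<in>UNIV. \<Sum>j\<in>UNIV. \<Sum>k\<in>UNIV. P x $ l $ k * partial_deriv l (\<lambda>x. P x $ i $ j) x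
              * (partial_deriv i u x * partial_deriv j v x * partial_deriv k w x))"
      by (rule sum.swap)
    also have "\<dots> = (\<Sum>i\<in>UNIV. \<Sum>j\<in>UNIV. \<Sum>l\<in>UNIV. \<Sum>k\<in>UNIV. P x $ l $ k * partial_deriv l (\<lambda>x. P x $ i $ j) x
              * (partial_deriv i u x * partial_deriv j v x * partial_deriv k w x))"
      by (intro sum.cong refl sum.swap)
    also have "\<dots> = (\<Sum>i\<in>UNIV. \<Sum>j\<in>UNIV. \<Sum>k\<in>UNIV. \<Sum>l\<in>UNIV. P x $ l $ k * partial_deriv l (\<lambda>x. P x $ i $ j) x
              * (partial_deriv i u x * partial_deriv j v x * partial_deriv k w x))"
      by (intro sum.cong refl sum.swap)
    also have "\<dots> = J u v w"
      by (simp add: J_def D_def sum_distrib_right)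
    finally show ?thesis
      by (simp add: bracket_of_eq_sum_field[of P "bracket_of P u v"] partial_deriv_bracket_of[OF skew P that]
          X_def[symmetric] T_def left_diff_distrib distrib_right sum.distrib sum_subtractf sum_distrib_right)
  qed
  \<comment> \<open>Rename the summation indices in the cyclic permutations of \<open>J\<close> so that all three sums have
    the common factor \<open>\<partial>\<^sub>if \<partial>\<^sub>jg \<partial>\<^sub>kh\<close>; the hypothesis on the entries is then its coefficient.\<close>
  have "J f g h + J g h f + J h f g = 0"
  proof -
    have "J g h f = (\<Sum>j\<in>UNIV. \<Sum>i\<in>UNIV. \<Sum>k\<in>UNIV.
        D j k i * (partial_deriv i f x * partial_deriv j g x * partial_deriv k h x))"
      unfolding J_def by (subst sum.swap[of _ UNIV UNIV]) (simp add: mult_ac)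
    also have "\<dots> = (\<Sum>i\<in>UNIV. \<Sum>j\<in>UNIV. \<Sum>k\<in>UNIV.
        D j k i * (partial_deriv i f x * partial_deriv j g x * partial_deriv k h x))"
      by (rule sum.swap)
    finally have 1: "J g h f = \<dots>" .
    have "J h f g = (\<Sum>i\<in>UNIV. \<Sum>k\<in>UNIV. \<Sum>j\<in>UNIV.
        D k i j * (partial_deriv i f x * partial_deriv j g x * partial_deriv k h x))"
      unfolding J_def by (subst sum.swap) (simp add: mult_ac)
    also have "\<dots> = (\<Sum>i\<in>UNIV. \<Sum>j\<in>UNIV. \<Sum>k\<in>UNIV.
        D k i j * (partial_deriv i f x * partial_deriv j g x * partial_deriv k h x))"
      by (intro sum.cong refl sum.swap)
    finally have 2: "J h f g = \<dots>" .
    have "D i j k + D j k i + D k i j = 0" for i j k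
      using jacobi[of k i j] by (simp add: D_def sum.distrib)
    then show ?thesis
      unfolding 1 2 by (simp add: J_def sum.distrib[symmetric] distrib_right[symmetric])
  qed
  then show ?thesis
    using nested f g h T_sym[OF f, of g h] T_sym[OF g, of h f] T_sym[OF h, of f g] by simp
qed

lemma poisson_structureI:
  fixes P :: "real^'n \<Rightarrow> real^'n^'n"
  assumes skew: "\<And>x. transpose (P x) = - P x"
    and P: "\<And>i j. smooth_fun (\<lambda>x. P x $ i $ j)"
    and jacobi: "\<And>x i j k. (\<Sum>l\<in>UNIV. P x $ l $ k * partial_deriv l (\<lambda>x. P x $ i $ j) x
        + P x $ l $ i * partial_deriv l (\<lambda>x. P x $ j $ k) x
        + P x $ l $ j * partial_deriv l (\<lambda>x. P x $ k $ i) x) = 0"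
  shows "poisson_structure P"
proof -
  have "grad (\<lambda>x. r * f x + s * g x) x = r *\<^sub>R grad f x + s *\<^sub>R grad g x"
    if "smooth_fun f" "smooth_fun g" for r s x and f g :: "real^'n \<Rightarrow> real"
    using that
    by (simp add: vec_eq_iff partial_deriv_eq_grad[symmetric] partial_deriv_add partial_deriv_mult
        smooth_fun_differentiable smooth_fun_intros)
  moreover have "grad (\<lambda>x. f x * g x) x = f x *\<^sub>R grad g x + g x *\<^sub>R grad f x"
    if "smooth_fun f" "smooth_fun g" for x and f g :: "real^'n \<Rightarrow> real"
    using that
    by (simp add: vec_eq_iff partial_deriv_eq_grad[symmetric] partial_deriv_mult
        smooth_fun_differentiable)
  ultimately show ?thesis
    unfolding poisson_structure_def poisson_bracket_def
    using skew smooth_fun_bracket_of[OF P] bracket_of_skew[OF skew] bracket_of_jacobi[OF skew P jacobi]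
    by (auto simp: fun_eq_iff bracket_of_def inner_add_left)
qed

section \<open>The realizations of the system\<close>

text \<open>
  The entries are affine in \<open>x\<close> with constant part governed by \<open>b\<close>, so the derivative is the
  same matrix with \<open>b = 0\<close>, evaluated at the increment.
\<close>

lemma has_derivative_Pi_mat:
  "((\<lambda>x. Pi_mat a b x $ i $ j) has_derivative (\<lambda>h. Pi_mat a 0 h $ i $ j)) (at x)"
proof -
  have "\<forall>i j. ((\<lambda>x. Pi_mat a b x $ i $ j) has_derivative (\<lambda>h. Pi_mat a 0 h $ i $ j)) (at x)"
    unfolding forall_3 Pi_mat_def vector_3
    by (intro conjI; (rule derivative_eq_intros bounded_linear_imp_has_derivative bounded_linear_vec_nth refl)+; simp)
  then show ?thesis by blast
qed

lemma smooth_fun_Pi_mat: "smooth_fun (\<lambda>x. Pi_mat a b x $ i $ j)"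
proof -
  have "\<forall>i j. smooth_fun (\<lambda>x. Pi_mat a b x $ i $ j)"
    unfolding forall_3 Pi_mat_def vector_3
    by (intro conjI smooth_fun_intros)
  then show ?thesis by blast
qed

text \<open>
  Conceptually, the entry condition for a matrix acting as \<open>v \<mapsto> w \<times> v\<close> says that
  \<open>w \<bullet> curl w = 0\<close>, and here \<open>w\<close> is a gradient.
\<close>

lemma poisson_structure_Pi_mat: "poisson_structure (Pi_mat a b)"
proof (rule poisson_structureI)
  show "transpose (Pi_mat a b x) = - Pi_mat a b x" for x
    by (simp add: transpose_def vec_eq_iff forall_3 Pi_mat_def)
  show "smooth_fun (\<lambda>x. Pi_mat a b x $ i $ j)" for i j
    by (rule smooth_fun_Pi_mat)
next
  fix x i j k
  have "\<forall>i j k. (\<Sum>l\<in>UNIV. Pi_mat a b x $ l $ k * Pi_mat a 0 (axis l 1) $ i $ j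
        + Pi_mat a b x $ l $ i * Pi_mat a 0 (axis l 1) $ j $ k
        + Pi_mat a b x $ l $ j * Pi_mat a 0 (axis l 1) $ k $ i) = 0"
    by (simp add: forall_3 sum_3 Pi_mat_def axis_def algebra_simps)
  then show "(\<Sum>l\<in>UNIV. Pi_mat a b x $ l $ k * partial_deriv l (\<lambda>x. Pi_mat a b x $ i $ j) x
        + Pi_mat a b x $ l $ i * partial_deriv l (\<lambda>x. Pi_mat a b x $ j $ k) x
        + Pi_mat a b x $ l $ j * partial_deriv l (\<lambda>x. Pi_mat a b x $ k $ i) x) = 0"
    by (simp add: partial_deriv_eqI[OF has_derivative_Pi_mat])
qed

lemma grad_Ham:
  "grad (Ham c d) x = vector [c * (x$2 + x$3) + d, c * (x$1 + x$3) + d, c * (x$1 + x$2) + d]"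
proof -
  have "(Ham c d has_derivative (\<lambda>h. c * (x$1 * h$2 + h$1 * x$2 + (x$2 * h$3 + h$2 * x$3)
      + (x$3 * h$1 + h$3 * x$1)) + d * (h$1 + h$2 + h$3))) (at x)"
    unfolding Ham_def
    by (rule derivative_eq_intros bounded_linear_imp_has_derivative bounded_linear_vec_nth refl)+ simp
  from partial_deriv_eqI[OF this] show ?thesis
    by (simp add: vec_eq_iff forall_3 partial_deriv_eq_grad[symmetric] axis_def algebra_simps)
qed

lemma smooth_fun_Ham: "smooth_fun (Ham c d)"
  unfolding Ham_def by (intro smooth_fun_intros)

text \<open>
  The product is alternating in the pairs \<open>(a, b)\<close> and \<open>(c, d)\<close>, hence equals the determinant
  times its value for the identity matrix, which is the system.
\<close>

lemma system_field_eq: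
  assumes "a * d - b * c = 1"
  shows "system_field x = Pi_mat a b x *v grad (Ham c d) x"
proof -
  have "Pi_mat a b x *v grad (Ham c d) x = (a * d - b * c) *\<^sub>R system_field x"
    by (simp add: vec_eq_iff forall_3 matrix_vector_mult_def sum_3 Pi_mat_def grad_Ham
        system_field_def algebra_simps)
  with assms show ?thesis by simp
qed

theorem proposition3:
  shows "infinite {(P, H). hamilton_poisson_realization P H system_field} \<and>
    infinite {(Pi_mat a b, Ham c d) | a b c d. a * d - b * c = 1} \<and>
    (\<forall>a b c d :: real. a * d - b * c = 1 \<longrightarrow>
       hamilton_poisson_realization (Pi_mat a b) (Ham c d) system_field)"
proof (intro conjI)
  let ?R = "{(P, H). hamilton_poisson_realization P H system_field}"
  let ?S = "{(Pi_mat a b, Ham c d) | a b c d. a * d - b * c = 1}"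
  show all: "\<forall>a b c d :: real. a * d - b * c = 1 \<longrightarrow>
      hamilton_poisson_realization (Pi_mat a b) (Ham c d) system_field"
    unfolding hamilton_poisson_realization_def
    using poisson_structure_Pi_mat smooth_fun_Ham system_field_eq by blast
  \<comment> \<open>The lower unitriangular matrices, \<open>a = d = 1\<close> and \<open>b = 0\<close>, already give infinitely many
    pairs: the value of the Hamiltonian at \<open>(1, 1, 0)\<close> is \<open>c + 2\<close>.\<close>
  have "inj (\<lambda>c. (Pi_mat 1 0, Ham c 1))"
  proof (rule injI)
    fix c c' :: real
    assume "(Pi_mat 1 0, Ham c 1) = (Pi_mat 1 0, Ham c' 1)"
    then have "Ham c 1 (vector [1, 1, 0]) = Ham c' 1 (vector [1, 1, 0])"
      by simp
    then show "c = c'"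
      by (simp add: Ham_def)
  qed
  then have "infinite (range (\<lambda>c. (Pi_mat 1 0, Ham c 1)))"
    using finite_imageD infinite_UNIV_char_0 by blast
  moreover have "range (\<lambda>c. (Pi_mat 1 0, Ham c 1)) \<subseteq> ?S"
    by force
  ultimately show S: "infinite ?S"
    using finite_subset by blast
  have "?S \<subseteq> ?R"
    using all by auto
  with S show "infinite ?R"
    using finite_subset by blast
qed

end
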